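(* Let $d \geq 2$ be an integer, let $\mathbb{F}$ be a field, and let $V$ be a vector space over $\mathbb{F}$ of dimension $d+1$. Let $\Phi = (A; \{E_i\}_{i=0}^d; A^*; \{E^*_i\}_{i=0}^d)$ be a Hessenberg system on $V$. If $\Phi$ is a Tridiagonal Hessenberg system (THS), then $\Phi$ is TD.
   Context: $\mathrm{End}(V)$ is the algebra of $\mathbb{F}$-linear maps $V\to V$. An element of $\mathrm{End}(V)$ is multiplicity-free if it is diagonalizable and every eigenspace has dimension one. For multiplicity-free $A$ with eigenspaces ordered $V_0,\dots,V_d$, the corresponding primitive idempotents are $E_0,\dots,E_d \in \mathrm{End}(V)$, where $E_i$ acts as the identity on $V_i$ and as $0$ on $V_j$ for $j\neq i$. The superscript $*$ in $A^*$, $E_i^*$ is just notation (not an adjoint). A Hessenberg system on $V$ is a sequence $\Phi=(A; \{E_i\}_{i=0}^d; A^*; \{E^*_i\}_{i=0}^d)$ of elements of $\mathrm{End}(V)$ such that: (i) $A$ and $A^*$ are multiplicity-free; (ii) $\{E_i\}_{i=0}^d$ is an ordering of the primitive idempotents of $A$; (iii) $\{E^*_i\}_{i=0}^d$ is an ordering of the primitive idempotents of $A^*$; (iv) for $0\le i,j\le d$, $E_iA^*E_j=0$ if $i-j>1$ and $E_iA^*E_j\neq 0$ if $i-j=1$; (v) for $0\le i,j\le d$, $E^*_iAE^*_j=0$ if $i-j>1$ and $E^*_iAE^*_j\neq 0$ if $i-j=1$. A Hessenberg system $\Phi$ is a Tridiagonal Hessenberg system (THS) if for all $0\le i,j\le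 d$ with $1<j-i$ we have $E_iA^*E_j=0$ and $E^*_iAE^*_j=0$. A Hessenberg system $\Phi$ is TD if there exist scalars $\beta,\gamma,\gamma^*,\varrho,\varrho^*\in\mathbb{F}$ such that $$0=[A, A^2A^*-\beta AA^*A+A^*A^2-\gamma(AA^*+A^*A)-\varrho A^*],$$ $$0=[A^*, A^{*2}A-\beta A^*AA^*+AA^{*2}-\gamma^*(A^*A+AA^* )-\varrho^*A],$$ where $[X,Y]=XY-YX$. *)

theory Defs
  imports Complex_Main
begin

text \<open>
  \<open>V\<close> is the type \<open>'v\<close> with scalar multiplication \<open>s\<close> over the field \<open>'a\<close>. Elements of
  \<open>End(V)\<close> are functions \<open>f\<close> with \<open>linear s s f\<close>; their product is composition.
  Families indexed by \<open>0, ..., d\<close> are functions on \<open>nat\<close>, whose values beyond \<open>d\<close> are ignored.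
\<close>

definition eigenspace ::
  "('a::field \<Rightarrow> 'v::ab_group_add \<Rightarrow> 'v) \<Rightarrow> ('v \<Rightarrow> 'v) \<Rightarrow> 'a \<Rightarrow> 'v set" where
  "eigenspace s f c = {v. f v = s c v}"

definition eigenvalues ::
  "('a::field \<Rightarrow> 'v::ab_group_add \<Rightarrow> 'v) \<Rightarrow> ('v \<Rightarrow> 'v) \<Rightarrow> 'a set" where
  "eigenvalues s f = {c. \<exists>v. v \<noteq> 0 \<and> f v = s c v}"

definition diagonalizable ::
  "('a::field \<Rightarrow> 'v::ab_group_add \<Rightarrow> 'v) \<Rightarrow> ('v \<Rightarrow> 'v) \<Rightarrow> bool" where
  "diagonalizable s f \<longleftrightarrow>
     (\<exists>B. \<not> module.dependent s B \<and> module.span s B = UNIV \<and> (\<forall>b\<in>B. \<exists>c. f b = s c b))"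

definition multiplicity_free ::
  "('a::field \<Rightarrow> 'v::ab_group_add \<Rightarrow> 'v) \<Rightarrow> ('v \<Rightarrow> 'v) \<Rightarrow> bool" where
  "multiplicity_free s f \<longleftrightarrow>
     Vector_Spaces.linear s s f \<and> diagonalizable s f \<and>
     (\<forall>c\<in>eigenvalues s f. vector_space.dim s (eigenspace s f c) = 1)"

text \<open>
  An ordering of the eigenspaces of \<open>f\<close> is given by an ordering \<open>\<theta> 0, ..., \<theta> d\<close> of its eigenvalues.
\<close>

definition primitive_idempotents ::
  "('a::field \<Rightarrow> 'v::ab_group_add \<Rightarrow> 'v) \<Rightarrow> nat \<Rightarrow> ('v \<Rightarrow> 'v) \<Rightarrow> (nat \<Rightarrow> 'v \<Rightarrow> 'v) \<Rightarrow> bool" where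
  "primitive_idempotents s d f E \<longleftrightarrow>
     (\<exists>\<theta>. bij_betw \<theta> {0..d} (eigenvalues s f) \<and>
        (\<forall>i\<in>{0..d}. Vector_Spaces.linear s s (E i) \<and>
           (\<forall>v\<in>eigenspace s f (\<theta> i). E i v = v) \<and>
           (\<forall>j\<in>{0..d}. j \<noteq> i \<longrightarrow> (\<forall>v\<in>eigenspace s f (\<theta> j). E i v = 0))))"

definition hessenberg_system ::
  "('a::field \<Rightarrow> 'v::ab_group_add \<Rightarrow> 'v) \<Rightarrow> nat \<Rightarrow>
   ('v \<Rightarrow> 'v) \<Rightarrow> (nat \<Rightarrow> 'v \<Rightarrow> 'v) \<Rightarrow> ('v \<Rightarrow> 'v) \<Rightarrow> (nat \<Rightarrow> 'v \<Rightarrow> 'v) \<Rightarrow> bool" where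
  "hessenberg_system s d A E As Es \<longleftrightarrow>
     multiplicity_free s A \<and> multiplicity_free s As \<and>
     primitive_idempotents s d A E \<and>
     primitive_idempotents s d As Es \<and>
     (\<forall>i\<in>{0..d}. \<forall>j\<in>{0..d}.
        (i > j + 1 \<longrightarrow> E i \<circ> As \<circ> E j = (\<lambda>_. 0)) \<and>
        (i = j + 1 \<longrightarrow> E i \<circ> As \<circ> E j \<noteq> (\<lambda>_. 0))) \<and>
     (\<forall>i\<in>{0..d}. \<forall>j\<in>{0..d}.
        (i > j + 1 \<longrightarrow> Es i \<circ> A \<circ> Es j = (\<lambda>_. 0)) \<and>
        (i = j + 1 \<longrightarrow> Es i \<circ> A \<circ> Es j \<noteq> (\<lambda>_. 0)))"

definition tridiagonal_hessenberg_system ::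
  "('a::field \<Rightarrow> 'v::ab_group_add \<Rightarrow> 'v) \<Rightarrow> nat \<Rightarrow>
   ('v \<Rightarrow> 'v) \<Rightarrow> (nat \<Rightarrow> 'v \<Rightarrow> 'v) \<Rightarrow> ('v \<Rightarrow> 'v) \<Rightarrow> (nat \<Rightarrow> 'v \<Rightarrow> 'v) \<Rightarrow> bool" where
  "tridiagonal_hessenberg_system s d A E As Es \<longleftrightarrow>
     hessenberg_system s d A E As Es \<and>
     (\<forall>i\<in>{0..d}. \<forall>j\<in>{0..d}. j > i + 1 \<longrightarrow>
        E i \<circ> As \<circ> E j = (\<lambda>_. 0) \<and> Es i \<circ> A \<circ> Es j = (\<lambda>_. 0))"

definition commutator :: "('v::ab_group_add \<Rightarrow> 'v) \<Rightarrow> ('v \<Rightarrow> 'v) \<Rightarrow> 'v \<Rightarrow> 'v" where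
  "commutator X Y = (\<lambda>v. X (Y v) - Y (X v))"

text \<open>
  The map \<open>X\<^sup>2Y - \<beta>XYX + YX\<^sup>2 - \<gamma>(XY + YX) - \<rho>Y\<close>.
\<close>

definition td_expr ::
  "('a::field \<Rightarrow> 'v::ab_group_add \<Rightarrow> 'v) \<Rightarrow> 'a \<Rightarrow> 'a \<Rightarrow> 'a \<Rightarrow> ('v \<Rightarrow> 'v) \<Rightarrow> ('v \<Rightarrow> 'v) \<Rightarrow> 'v \<Rightarrow> 'v" where
  "td_expr s \<beta> \<gamma> \<rho> X Y =
     (\<lambda>v. X (X (Y v)) - s \<beta> (X (Y (X v))) + Y (X (X v)) - s \<gamma> (X (Y v) + Y (X v)) - s \<rho> (Y v))"

definition TD_system ::
  "('a::field \<Rightarrow> 'v::ab_group_add \<Rightarrow> 'v) \<Rightarrow> nat \<Rightarrow>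
   ('v \<Rightarrow> 'v) \<Rightarrow> (nat \<Rightarrow> 'v \<Rightarrow> 'v) \<Rightarrow> ('v \<Rightarrow> 'v) \<Rightarrow> (nat \<Rightarrow> 'v \<Rightarrow> 'v) \<Rightarrow> bool" where
  "TD_system s d A E As Es \<longleftrightarrow>
     hessenberg_system s d A E As Es \<and>
     (\<exists>\<beta> \<gamma> \<gamma>s \<rho> \<rho>s.
        commutator A (td_expr s \<beta> \<gamma> \<rho> A As) = (\<lambda>_. 0) \<and>
        commutator As (td_expr s \<beta> \<gamma>s \<rho>s As A) = (\<lambda>_. 0))"

end

theory Submission
  imports Defs "HOL-Computational_Algebra.Polynomial"
begin

text \<open>
  In the eigenbasis of \<open>A\<close>, where \<open>A\<^sup>*\<close> is tridiagonal, the first relation holds as soon as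
  \<open>\<theta>\<^sub>i\<^sup>2 - \<beta>\<theta>\<^sub>i\<theta>\<^sub>j + \<theta>\<^sub>j\<^sup>2 - \<gamma>(\<theta>\<^sub>i + \<theta>\<^sub>j) - \<rho> = 0\<close> for neighbouring indices. If \<open>d = 2\<close>, this can be
  solved for \<open>\<gamma>, \<rho>\<close> with \<open>\<beta> = 0\<close>. If \<open>d \<ge> 3\<close>, interpolation gives a polynomial \<open>p\<close> with
  \<open>A\<^sup>2A\<^sup>*A - AA\<^sup>*A\<^sup>2 = p(A)A\<^sup>* - A\<^sup>*p(A)\<close>. In the eigenbasis of \<open>A\<^sup>*\<close>, where the subdiagonal of \<open>A\<close> does not
  vanish, the extreme entry of this identity in the column \<open>0\<close> shows that \<open>p\<close> has degree at most
  \<open>3\<close> and that its cubic coefficient \<open>k\<close> satisfies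
  \<open>\<theta>\<^sup>*\<^sub>1 - \<theta>\<^sup>*\<^sub>2 = k(\<theta>\<^sup>*\<^sub>0 - \<theta>\<^sup>*\<^sub>3)\<close>; hence \<open>k \<noteq> 0\<close> and \<open>\<beta> = 1/k - 1\<close> works. The quadratic equations force
  \<open>\<theta>\<^sub>1 - \<theta>\<^sub>2 = k(\<theta>\<^sub>0 - \<theta>\<^sub>3)\<close> with the same \<open>k\<close>, so exchanging \<open>A\<close> and \<open>A\<^sup>*\<close> leads to the same \<open>\<beta>\<close>.
\<close>

section \<open>Linear maps and interpolation\<close>

lemma lin_add: "Vector_Spaces.linear s t f \<Longrightarrow> f (x + y) = f x + f y"
  and lin_scale: "Vector_Spaces.linear s t f \<Longrightarrow> f (s k x) = t k (f x)"
  and lin_diff: "Vector_Spaces.linear s t f \<Longrightarrow> f (x - y) = f x - f y"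
  and lin_zero: "Vector_Spaces.linear s t f \<Longrightarrow> f 0 = 0"
  and lin_sum: "Vector_Spaces.linear s t f \<Longrightarrow> f (sum h I) = (\<Sum>i\<in>I. f (h i))"
  unfolding Vector_Spaces.linear_iff_module_hom
  by (simp_all add: module_hom.add module_hom.scale module_hom.diff module_hom.zero module_hom.sum)

text \<open>Newton's scheme: a multiple of \<open>q\<close>, which vanishes at the earlier nodes,
  corrects the value at the new node and leaves the others alone.\<close>

lemma polynomial_interpolation:
  fixes x y :: "nat \<Rightarrow> 'a::field"
  assumes "inj_on x {0..n}"
  shows "\<exists>p. degree p \<le> n \<and> (\<forall>i\<le>n. poly p (x i) = y i)"
  using assms
proof (induction n)
  case 0
  show ?case by (rule exI[of _ "[:y 0:]"]) simp
next
  case (Suc n)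
  then have "inj_on x {0..n}"
    by (auto intro: inj_on_subset)
  then obtain p where p: "degree p \<le> n" "\<And>i. i \<le> n \<Longrightarrow> poly p (x i) = y i"
    using Suc.IH by blast
  define q where "q = (\<Prod>i\<le>n. [:- x i, 1:])"
  have deg: "degree q \<le> Suc n"
    unfolding q_def using degree_prod_sum_le[of "{..n}" "\<lambda>i. [:- x i, 1:]"] by simp
  have root: "poly q (x i) = 0" if "i \<le> n" for i
    using that by (auto simp: q_def poly_prod)
  have nz: "poly q (x (Suc n)) \<noteq> 0"
    using Suc.prems by (auto simp: q_def poly_prod dest: inj_onD)
  define k where "k = (y (Suc n) - poly p (x (Suc n))) / poly q (x (Suc n))"
  have "degree (p + smult k q) \<le> Suc n"
    using p(1) deg by (intro degree_add_le) (auto intro: order_trans[OF degree_smult_le])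
  moreover have "poly (p + smult k q) (x i) = y i" if "i \<le> Suc n" for i
    using that p(2) root nz by (auto simp: le_Suc_eq k_def)
  ultimately show ?case by blast
qed

section \<open>Polynomials in an operator and coordinates in an eigenbasis\<close>

definition poly_op :: "('a::field \<Rightarrow> 'v::ab_group_add \<Rightarrow> 'v) \<Rightarrow> 'a poly \<Rightarrow> ('v \<Rightarrow> 'v) \<Rightarrow> 'v \<Rightarrow> 'v" where
  "poly_op s p f x = (\<Sum>k\<le>degree p. s (coeff p k) ((f ^^ k) x))"

text \<open>
  The \<open>c i\<close> are the coordinate functionals of the eigenbasis \<open>v 0, ..., v d\<close>; the idempotent
  \<open>E i\<close> is then \<open>x \<mapsto> c i x \<cdot> v i\<close>.
\<close>

locale eigenbasis = vector_space s
  for s :: "'a::field \<Rightarrow> 'v::ab_group_add \<Rightarrow> 'v" +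
  fixes d :: nat and f :: "'v \<Rightarrow> 'v" and \<theta> :: "nat \<Rightarrow> 'a" and v :: "nat \<Rightarrow> 'v"
    and c :: "nat \<Rightarrow> 'v \<Rightarrow> 'a"
  assumes inj: "inj_on \<theta> {0..d}"
    and lin: "Vector_Spaces.linear s s f"
    and c_lin: "i \<le> d \<Longrightarrow> Vector_Spaces.linear s (*) (c i)"
    and c_v: "i \<le> d \<Longrightarrow> j \<le> d \<Longrightarrow> c i (v j) = (if i = j then 1 else 0)"
    and expand: "(\<Sum>i\<le>d. s (c i x) (v i)) = x"
    and f_v: "i \<le> d \<Longrightarrow> f (v i) = s (\<theta> i) (v i)"
begin

lemmas c_simps = lin_add[OF c_lin] lin_scale[OF c_lin] lin_diff[OF c_lin] lin_zero[OF c_lin]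
  lin_sum[OF c_lin]

lemma theta_eq_iff: "i \<le> d \<Longrightarrow> j \<le> d \<Longrightarrow> \<theta> i = \<theta> j \<longleftrightarrow> i = j"
  using inj by (auto simp: inj_on_def)

lemma linear_expand:
  assumes "Vector_Spaces.linear s t g"
  shows "g x = (\<Sum>j\<le>d. t (c j x) (g (v j)))"
proof -
  have "g x = g (\<Sum>i\<le>d. s (c i x) (v i))" by (simp only: expand)
  then show ?thesis by (simp add: lin_sum[OF assms] lin_scale[OF assms])
qed

lemma coordinate_eqI:
  assumes "\<And>i. i \<le> d \<Longrightarrow> c i x = c i y"
  shows "x = y"
proof -
  have "(\<Sum>i\<le>d. s (c i x) (v i)) = (\<Sum>i\<le>d. s (c i y) (v i))"
    by (intro sum.cong) (simp_all add: assms)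
  then show ?thesis by (simp only: expand)
qed

lemma c_f: assumes "i \<le> d" shows "c i (f x) = \<theta> i * c i x"
proof -
  have "c i (f x) = (\<Sum>j\<le>d. c j x * c i (f (v j)))"
    using assms by (subst linear_expand[OF lin]) (simp add: c_simps)
  also have "\<dots> = (\<Sum>j\<le>d. if j = i then \<theta> i * c i x else 0)"
    using assms by (intro sum.cong) (auto simp: f_v c_simps c_v)
  finally show ?thesis using assms by simp
qed

lemma c_poly_op: assumes "i \<le> d" shows "c i (poly_op s p f x) = poly p (\<theta> i) * c i x"
proof -
  have "c i ((f ^^ k) x) = \<theta> i ^ k * c i x" for k
    by (induction k) (simp_all add: assms c_f)
  then have "c i (poly_op s p f x) = (\<Sum>k\<le>degree p. coeff p k * (\<theta> i ^ k * c i x))"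
    by (simp add: poly_op_def lin_sum[OF c_lin[OF assms]] lin_scale[OF c_lin[OF assms]])
  then show ?thesis
    by (simp add: poly_altdef sum_distrib_right mult.assoc)
qed

lemma poly_op_v: assumes "i \<le> d" shows "poly_op s p f (v i) = s (poly p (\<theta> i)) (v i)"
  by (rule coordinate_eqI) (use assms in \<open>auto simp: c_poly_op c_simps c_v\<close>)

lemma linear_f_power: "Vector_Spaces.linear s s (f ^^ k)"
proof (induction k)
  case 0
  show ?case using linear_ident by (simp add: id_def)
next
  case (Suc k)
  from Vector_Spaces.linear_compose[OF this lin] show ?case by (simp add: o_def)
qed

lemma poly_op_scale: "poly_op s p f (s a x) = s a (poly_op s p f x)"
  by (simp add: poly_op_def lin_scale[OF linear_f_power] scale_sum_right mult.commute)

text \<open>Reduces operator identities to scalar ones: in entry \<open>(i, j)\<close>, a factor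
  \<open>f\<close> on the far left acts as \<open>\<theta> i\<close> and one on the far right as
  \<open>\<theta> j\<close>.\<close>

lemma matrix_ext:
  assumes "\<And>x y. h (x + y) = h x + h y" "\<And>a x. h (s a x) = s a (h x)"
    and "\<And>i j. i \<le> d \<Longrightarrow> j \<le> d \<Longrightarrow> c i (h (v j)) = 0"
  shows "h x = 0"
proof -
  have "h (v j) = 0" if "j \<le> d" for j
    by (rule coordinate_eqI) (use assms(3) that in \<open>simp add: c_simps\<close>)
  moreover have "Vector_Spaces.linear s s h"
    using assms(1,2) by (simp add: Vector_Spaces.linear_iff vector_space_axioms)
  ultimately show ?thesis by (subst linear_expand) auto
qed

end

section \<open>From primitive idempotents to coordinates\<close>

text \<open>The eigenspaces are lines, so \<open>E i x\<close> is a multiple of one fixed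
  eigenvector \<open>v i\<close>; the factor is the coordinate \<open>c i x\<close>.\<close>

lemma exists_eigenbasis:
  fixes s :: "'a::field \<Rightarrow> 'v::ab_group_add \<Rightarrow> 'v"
  assumes "vector_space s" and mf: "multiplicity_free s f" and pi: "primitive_idempotents s d f E"
  obtains \<theta> v c where "eigenbasis s d f \<theta> v c" "\<And>i x. i \<le> d \<Longrightarrow> E i x = s (c i x) (v i)"
proof -
  interpret vector_space s by fact
  from pi obtain \<theta> where bij: "bij_betw \<theta> {0..d} (eigenvalues s f)"
    and E_lin: "\<And>i. i \<le> d \<Longrightarrow> Vector_Spaces.linear s s (E i)"
    and E_same: "\<And>i x. i \<le> d \<Longrightarrow> x \<in> eigenspace s f (\<theta> i) \<Longrightarrow> E i x = x"
    and E_other: "\<And>i j x. i \<le> d \<Longrightarrow> j \<le> d \<Longrightarrow> j \<noteq> i \<Longrightarrow> x \<in> eigenspace s f (\<theta> j) \<Longrightarrow> E i x = 0"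
    unfolding primitive_idempotents_def by fastforce
  have lin: "Vector_Spaces.linear s s f" using mf by (simp add: multiplicity_free_def)
  obtain B where indep: "independent B" and sp: "span B = UNIV"
    and Beig: "\<And>b. b \<in> B \<Longrightarrow> \<exists>k. f b = s k b"
    using mf unfolding multiplicity_free_def diagonalizable_def by blast
  have Bcase: "\<exists>j\<le>d. b \<in> eigenspace s f (\<theta> j)" if "b \<in> B" for b
  proof -
    obtain k where k: "f b = s k b" using Beig \<open>b \<in> B\<close> by blast
    have "b \<noteq> 0" using indep that dependent_zero by blast
    then have "k \<in> eigenvalues s f" using k by (auto simp: eigenvalues_def)
    then obtain j where "j \<le> d" "k = \<theta> j" using bij by (metis atLeastAtMost_iff bij_betw_imp_surj_on image_iff)
    then show ?thesis using k by (auto simp: eigenspace_def)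
  qed
  \<comment> \<open>It suffices to look at \<open>B\<close>: each of its elements is fixed by one
    \<open>E j\<close> and killed by the others.\<close>
  have E_sum: "(\<Sum>i\<le>d. E i x) = x" for x
  proof -
    have "x \<in> span B" using sp by simp
    then show ?thesis
    proof (induction rule: span_induct_alt)
      case base
      then show ?case by (simp add: lin_zero[OF E_lin])
    next
      case (step k b y)
      obtain j where j: "j \<le> d" "b \<in> eigenspace s f (\<theta> j)" using Bcase step by blast
      have "(\<Sum>i\<le>d. E i b) = (\<Sum>i\<le>d. if i = j then b else 0)"
        using j E_same E_other by (intro sum.cong) auto
      then have "(\<Sum>i\<le>d. E i b) = b" using j by simp
      then show ?case
        using step by (simp add: lin_add[OF E_lin] lin_scale[OF E_lin] sum.distrib
            flip: scale_sum_right)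
    qed
  qed
  have E_range: "E i x \<in> eigenspace s f (\<theta> i)" if "i \<le> d" for i x
  proof -
    have "x \<in> span B" using sp by simp
    then show ?thesis
    proof (induction rule: span_induct_alt)
      case base
      then show ?case by (simp add: lin_zero[OF E_lin] lin_zero[OF lin] that eigenspace_def)
    next
      case (step k b y)
      obtain j where j: "j \<le> d" "b \<in> eigenspace s f (\<theta> j)" using Bcase step by blast
      have "E i b \<in> eigenspace s f (\<theta> i)"
        using j E_same E_other[OF that, of j b] that
        by (cases "j = i") (auto simp: eigenspace_def lin_zero[OF lin])
      then show ?case
        using step that by (simp add: eigenspace_def lin_add[OF E_lin] lin_scale[OF E_lin]
            lin_add[OF lin] lin_scale[OF lin] scale_right_distrib mult.commute)
    qed
  qed
  have "\<exists>u. u \<noteq> 0 \<and> f u = s (\<theta> i) u \<and> eigenspace s f (\<theta> i) \<subseteq> span {u}" if "i \<le> d" for i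
  proof -
    have "\<theta> i \<in> eigenvalues s f" using bij that by (auto simp: bij_betw_def)
    then have "dim (eigenspace s f (\<theta> i)) = 1" using mf by (auto simp: multiplicity_free_def)
    then obtain b where b: "b \<subseteq> eigenspace s f (\<theta> i)" "independent b"
        "eigenspace s f (\<theta> i) \<subseteq> span b" "card b = 1"
      using basis_exists[of "eigenspace s f (\<theta> i)"] by metis
    then obtain u where "b = {u}" by (auto simp: card_1_singleton_iff)
    with b show ?thesis by (intro exI[of _ u]) (auto simp: eigenspace_def)
  qed
  then obtain v where v: "\<And>i. i \<le> d \<Longrightarrow> v i \<noteq> 0" "\<And>i. i \<le> d \<Longrightarrow> f (v i) = s (\<theta> i) (v i)"
      "\<And>i. i \<le> d \<Longrightarrow> eigenspace s f (\<theta> i) \<subseteq> span {v i}"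
    by metis
  have "\<exists>k. E i x = s k (v i)" if "i \<le> d" for i x
    using E_range[OF that, of x] v(3)[OF that] by (auto simp: span_singleton)
  then obtain c where c: "\<And>i x. i \<le> d \<Longrightarrow> E i x = s (c i x) (v i)" by metis
  have "eigenbasis s d f \<theta> v c"
  proof (intro eigenbasis.intro eigenbasis_axioms.intro)
    show "vector_space s" by fact
    show "inj_on \<theta> {0..d}" using bij by (simp add: bij_betw_def)
    show "Vector_Spaces.linear s s f" by fact
    show "(\<Sum>i\<le>d. s (c i x) (v i)) = x" for x using E_sum[of x] c by simp
    show "f (v i) = s (\<theta> i) (v i)" if "i \<le> d" for i using v that by simp
    show "c i (v j) = (if i = j then 1 else 0)" if "i \<le> d" "j \<le> d" for i j
    proof -
      have "E i (v j) = s (if i = j then 1 else 0) (v i)"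
        using that E_same[of i "v j"] E_other[of i j "v j"] v by (auto simp: eigenspace_def)
      then show ?thesis unfolding c[OF that(1)] scale_cancel_right using v(1)[OF that(1)] by blast
    qed
    show "Vector_Spaces.linear s (*) (c i)" if "i \<le> d" for i
    proof -
      have "s (c i (x + y)) (v i) = s (c i x + c i y) (v i)" for x y
        using c that lin_add[OF E_lin[OF that], of x y] by (simp add: scale_left_distrib)
      moreover have "s (c i (s k x)) (v i) = s (k * c i x) (v i)" for k x
        using c that lin_scale[OF E_lin[OF that], of k x] by simp
      moreover have "vector_space ((*) :: 'a \<Rightarrow> 'a \<Rightarrow> 'a)"
        by unfold_locales (auto simp: algebra_simps)
      ultimately show ?thesis
        using v(1)[OF that] vector_space_axioms by (auto simp: Vector_Spaces.linear_iff)
    qed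
  qed
  with c that show thesis by blast
qed

section \<open>Operator identities checked entry by entry\<close>

text \<open>
  \<open>f\<close> and \<open>g\<close> play the roles of \<open>A\<close> and \<open>A\<^sup>*\<close>, or the other way round. Only the hypotheses
  needed for the relation with \<open>f\<close> on the outside are recorded.
\<close>

locale half_tridiagonal_pair =
  F: eigenbasis s d f \<theta> v c + G: eigenbasis s d g \<phi> w e
  for s :: "'a::field \<Rightarrow> 'v::ab_group_add \<Rightarrow> 'v" and d f \<theta> v c g \<phi> w e +
  assumes tri: "i \<le> d \<Longrightarrow> j \<le> d \<Longrightarrow> i > j + 1 \<or> j > i + 1 \<Longrightarrow> c i (g (v j)) = 0"
    and hess: "i \<le> d \<Longrightarrow> j \<le> d \<Longrightarrow> i > j + 1 \<Longrightarrow> e i (f (w j)) = 0"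
    and sub: "Suc j \<le> d \<Longrightarrow> e (Suc j) (f (w j)) \<noteq> 0"
begin

lemmas f_simps = lin_add[OF F.lin] lin_scale[OF F.lin] lin_diff[OF F.lin] lin_zero[OF F.lin]
lemmas g_simps = lin_add[OF G.lin] lin_scale[OF G.lin] lin_diff[OF G.lin] lin_zero[OF G.lin]

text \<open>Entry \<open>(i, j)\<close> is \<open>(\<theta> i - \<theta> j) * ?Q\<close> times that
  of \<open>g\<close>. The first factor vanishes on the diagonal, the entry of \<open>g\<close> off
  the band, and \<open>?Q\<close> at neighbours, where its symmetry covers both orders.\<close>

lemma td_relation:
  assumes quad: "\<And>i. Suc i \<le> d \<Longrightarrow>
    (\<theta> (Suc i))\<^sup>2 - \<beta> * \<theta> (Suc i) * \<theta> i + (\<theta> i)\<^sup>2 - \<gamma> * (\<theta> (Suc i) + \<theta> i) - \<rho> = 0"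
  shows "commutator f (td_expr s \<beta> \<gamma> \<rho> f g) = (\<lambda>_. 0)"
proof
  fix x
  show "commutator f (td_expr s \<beta> \<gamma> \<rho> f g) x = 0"
  proof (rule F.matrix_ext[where h = "commutator f (td_expr s \<beta> \<gamma> \<rho> f g)"])
    fix i j assume ij: "i \<le> d" "j \<le> d"
    let ?Q = "(\<theta> i)\<^sup>2 - \<beta> * \<theta> i * \<theta> j + (\<theta> j)\<^sup>2 - \<gamma> * (\<theta> i + \<theta> j) - \<rho>"
    have "c i (commutator f (td_expr s \<beta> \<gamma> \<rho> f g) (v j)) = (\<theta> i - \<theta> j) * ?Q * c i (g (v j))"
      using ij by (simp add: commutator_def td_expr_def F.f_v f_simps g_simps F.c_simps F.c_f
          algebra_simps power2_eq_square)
    moreover consider "i = j" | "i > j + 1 \<or> j > i + 1" | "i = Suc j" | "j = Suc i" by linarith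
    then have "(\<theta> i - \<theta> j) * ?Q * c i (g (v j)) = 0"
    proof cases
      case 3
      then show ?thesis using quad[of j] ij by simp
    next
      case 4
      then show ?thesis using quad[of i] ij by (simp add: algebra_simps)
    qed (use ij tri in auto)
    ultimately show "c i (commutator f (td_expr s \<beta> \<gamma> \<rho> f g) (v j)) = 0" by simp
  qed (simp_all add: commutator_def td_expr_def f_simps g_simps F.scale_right_distrib
      F.scale_right_diff_distrib F.scale_scale mult.commute)
qed

text \<open>Since \<open>g\<close> is tridiagonal, only neighbouring eigenvalues impose a condition
  on \<open>p\<close>, and interpolation can meet all of them.\<close>

lemma poly_relation:
  assumes p: "\<And>i. Suc i \<le> d \<Longrightarrow>
    poly p (\<theta> (Suc i)) - poly p (\<theta> i) = \<theta> (Suc i) * \<theta> i * (\<theta> (Suc i) - \<theta> i)"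
  shows "f (f (g (f x))) - f (g (f (f x))) = poly_op s p f (g x) - g (poly_op s p f x)"
proof -
  have "f (f (g (f x))) - f (g (f (f x))) - (poly_op s p f (g x) - g (poly_op s p f x)) = 0"
    (is "?h x = 0")
  proof (rule F.matrix_ext[where h = "\<lambda>x. f (f (g (f x))) - f (g (f (f x))) - (poly_op s p f (g x) - g (poly_op s p f x))"])
    fix i j assume ij: "i \<le> d" "j \<le> d"
    have "c i (?h (v j)) = (\<theta> i * \<theta> j * (\<theta> i - \<theta> j) - (poly p (\<theta> i) - poly p (\<theta> j))) * c i (g (v j))"
      using ij by (simp add: F.f_v f_simps g_simps F.c_simps F.c_f F.c_poly_op F.poly_op_v
          algebra_simps)
    moreover consider "i = j" | "i > j + 1 \<or> j > i + 1" | "i = Suc j" | "j = Suc i" by linarith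
    then have "(\<theta> i * \<theta> j * (\<theta> i - \<theta> j) - (poly p (\<theta> i) - poly p (\<theta> j))) * c i (g (v j)) = 0"
    proof cases
      case 3
      then show ?thesis using p[of j] ij by simp
    next
      case 4
      then show ?thesis using p[of i] ij by (simp add: algebra_simps)
    qed (use ij tri in auto)
    ultimately show "c i (?h (v j)) = 0" by simp
  next
    have *: "poly_op s p f (y + z) = poly_op s p f y + poly_op s p f z" for y z
      by (simp add: poly_op_def lin_add[OF F.linear_f_power] F.scale_right_distrib sum.distrib)
    show "?h (y + z) = ?h y + ?h z" for y z by (simp add: f_simps g_simps *)
  qed (simp add: f_simps g_simps F.poly_op_scale F.scale_right_diff_distrib)
  then show ?thesis by simp
qed

section \<open>Leading coordinates along a flag\<close>

text \<open>
  Membership in the span of \<open>w 0, ..., w m\<close>, a flag which \<open>f\<close> raises by exactly one step.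
\<close>

definition below :: "nat \<Rightarrow> 'v \<Rightarrow> bool" where
  "below m x \<longleftrightarrow> (\<forall>i\<le>d. i > m \<longrightarrow> e i x = 0)"

lemma e_f:
  assumes "i \<le> d"
  shows "e i (f x) = (\<Sum>j\<le>d. e j x * e i (f (w j)))"
  using assms by (subst G.linear_expand[OF F.lin]) (simp add: G.c_simps)

lemma below_f: assumes "below m x" shows "below (Suc m) (f x)"
  unfolding below_def
proof (intro allI impI)
  fix i assume i: "i \<le> d" "Suc m < i"
  have "e j x * e i (f (w j)) = 0" if "j \<le> d" for j
    using assms hess[of i j] i that by (cases "j > m") (auto simp: below_def)
  then show "e i (f x) = 0" unfolding e_f[OF i(1), of x] by (intro sum.neutral) auto
qed

text \<open>By \<open>hess\<close> no \<open>w j\<close> with \<open>j < m\<close> reaches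
  \<open>w (Suc m)\<close>, and \<open>x\<close> has no component beyond \<open>m\<close>; only
  \<open>j = m\<close> contributes.\<close>

lemma e_Suc_f:
  assumes "below m x" "Suc m \<le> d"
  shows "e (Suc m) (f x) = e (Suc m) (f (w m)) * e m x"
proof -
  have "e j x * e (Suc m) (f (w j)) = (if j = m then e (Suc m) (f (w m)) * e m x else 0)"
    if "j \<le> d" for j
    using assms hess[of "Suc m" j] that by (cases j m rule: linorder_cases) (auto simp: below_def)
  then have "e (Suc m) (f x) = (\<Sum>j\<le>d. if j = m then e (Suc m) (f (w m)) * e m x else 0)"
    unfolding e_f[OF assms(2), of x] by (intro sum.cong) blast+
  then show ?thesis using assms(2) by simp
qed

lemma below_g: "below m x \<Longrightarrow> below m (g x)"
  by (simp add: below_def G.c_f)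

lemma below_w: "j \<le> d \<Longrightarrow> below j (w j)"
  by (simp add: below_def G.c_v)

lemma below_power: "j \<le> d \<Longrightarrow> below (j + k) ((f ^^ k) (w j))"
  by (induction k) (simp_all add: below_w below_f)

text \<open>The coordinate is a product of consecutive subdiagonal entries of
  \<open>f\<close>.\<close>

lemma e_power_nonzero: "j + k \<le> d \<Longrightarrow> e (j + k) ((f ^^ k) (w j)) \<noteq> 0"
  by (induction k) (use e_Suc_f below_power sub G.c_v in auto)

text \<open>Powers below \<open>n\<close> do not reach \<open>w (j + n)\<close>. As the degree is
  only bounded, \<open>coeff p n\<close> may be 0; so \<open>n = 3\<close> can be used before the
  exact degree is known.\<close>

lemma e_poly_op:
  assumes "j + n \<le> d" "degree p \<le> n"
  shows "e (j + n) (poly_op s p f (w j)) = coeff p n * e (j + n) ((f ^^ n) (w j))"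
proof -
  have "e (j + n) (poly_op s p f (w j)) =
      (\<Sum>k\<le>degree p. coeff p k * e (j + n) ((f ^^ k) (w j)))"
    using assms by (simp add: poly_op_def G.c_simps)
  also have "\<dots> = (\<Sum>k\<le>n. coeff p k * e (j + n) ((f ^^ k) (w j)))"
    using assms by (intro sum.mono_neutral_left) (auto simp: coeff_eq_0)
  also have "\<dots> = (\<Sum>k\<le>n. if k = n then coeff p n * e (j + n) ((f ^^ n) (w j)) else 0)"
    using assms below_power[of j] by (intro sum.cong) (auto simp: below_def)
  finally show ?thesis by simp
qed

lemma e_poly_commutator:
  assumes "j + n \<le> d" "degree p \<le> n"
  shows "e (j + n) (poly_op s p f (g (w j)) - g (poly_op s p f (w j))) =
    coeff p n * (\<phi> j - \<phi> (j + n)) * e (j + n) ((f ^^ n) (w j))"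
  using assms e_poly_op[OF assms]
  by (simp add: G.f_v F.poly_op_scale G.c_simps G.c_f algebra_simps)

section \<open>Quadratic relations between neighbouring eigenvalues\<close>

text \<open>The last conjunct expresses \<open>k\<close> through the eigenvalues of the other
  operator, which later allows the constants of the two operators to be compared.\<close>

lemma recurrence:
  assumes "d \<ge> 3"
  shows "\<exists>k \<gamma> \<rho>. k \<noteq> 0 \<and> (\<forall>i. Suc i \<le> d \<longrightarrow>
      (\<theta> (Suc i))\<^sup>2 - (1 / k - 1) * \<theta> (Suc i) * \<theta> i + (\<theta> i)\<^sup>2 - \<gamma> * (\<theta> (Suc i) + \<theta> i) - \<rho> = 0)
    \<and> \<phi> 1 - \<phi> 2 = k * (\<phi> 0 - \<phi> 3)"
proof -
  \<comment> \<open>A telescoping sum: its increments are the ones \<open>poly_relation\<close> asks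
    for.\<close>
  define y where "y n = (\<Sum>i<n. \<theta> (Suc i) * \<theta> i * (\<theta> (Suc i) - \<theta> i))" for n
  obtain p where deg: "degree p \<le> d" and p_val: "\<And>i. i \<le> d \<Longrightarrow> poly p (\<theta> i) = y i"
    using polynomial_interpolation[OF F.inj, of y] by blast
  have p: "poly p (\<theta> (Suc i)) - poly p (\<theta> i) = \<theta> (Suc i) * \<theta> i * (\<theta> (Suc i) - \<theta> i)"
    if "Suc i \<le> d" for i
    using that p_val[of i] p_val[of "Suc i"] by (simp add: y_def)
  \<comment> \<open>Starting at \<open>w 0\<close> leaves room for every coordinate up to
    \<open>d\<close>, hence for any possible \<open>degree p\<close>.\<close>
  let ?L = "f (f (g (f (w 0)))) - f (g (f (f (w 0))))"
  have rel: "?L = poly_op s p f (g (w 0)) - g (poly_op s p f (w 0))"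
    using poly_relation[OF p] .
  have b1: "below 1 (f (w 0))" and b2: "below 2 (f (f (w 0)))"
    using below_power[of 0 1] below_power[of 0 2] by (simp_all add: numeral_eq_Suc)
  have b3: "below 2 (f (g (f (w 0))))"
    using below_f[OF below_g[OF b1]] by (simp add: numeral_eq_Suc)
  have b4: "below 3 (f (f (g (f (w 0)))))" and b5: "below 3 (f (g (f (f (w 0)))))"
    using below_f[OF b3] below_f[OF below_g[OF b2]] by (simp_all add: numeral_eq_Suc)
  have deg3: "degree p \<le> 3"
  proof (rule ccontr)
    assume "\<not> degree p \<le> 3"
    \<comment> \<open>\<open>?L\<close> climbs only three steps, whereas on the other side the
      leading coefficient of \<open>p\<close> survives.\<close>
    then have "e (degree p) ?L = 0" and "p \<noteq> 0"
      using b4 b5 deg by (auto simp: below_def G.c_simps)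
    then have "coeff p (degree p) * (\<phi> 0 - \<phi> (degree p)) * e (degree p) ((f ^^ degree p) (w 0)) = 0"
      using e_poly_commutator[of 0 "degree p" p] rel deg by simp
    then show False
      using e_power_nonzero[of 0 "degree p"] G.theta_eq_iff[of 0 "degree p"] deg \<open>p \<noteq> 0\<close>
        \<open>\<not> degree p \<le> 3\<close> by auto
  qed
  define k where "k = coeff p 3"
  define M where "M = e 3 (f (f (f (w 0))))"
  have M: "M \<noteq> 0" using e_power_nonzero[of 0 3] assms by (simp add: M_def numeral_eq_Suc)
  \<comment> \<open>The weight of the only path from \<open>w 0\<close> to \<open>w 3\<close> in
    three steps. In the two terms of \<open>?L\<close>, \<open>g\<close> acts on it at level 1 and
    at level 2, giving \<open>\<phi> 1 - \<phi> 2\<close>.\<close>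
  define m where "m = e 3 (f (w 2)) * e 2 (f (w 1)) * e 1 (f (w 0))"
  have up2: "e 2 (f x) = e 2 (f (w 1)) * e 1 x" if "below 1 x" for x
    using e_Suc_f[OF that] assms by (simp add: numeral_eq_Suc)
  have up3: "e 3 (f x) = e 3 (f (w 2)) * e 2 x" if "below 2 x" for x
    using e_Suc_f[OF that] assms by (simp add: numeral_eq_Suc)
  have "M = m"
    using up3[OF b2] up2[OF b1] by (simp add: M_def m_def)
  moreover have "e 3 ?L = (\<phi> 1 - \<phi> 2) * m"
    using assms up3[OF b3] up2[OF below_g[OF b1]] up3[OF below_g[OF b2]] up2[OF b1]
    by (simp add: G.c_simps G.c_f m_def algebra_simps)
  moreover have "e 3 ?L = k * (\<phi> 0 - \<phi> 3) * M"
    using e_poly_commutator[of 0 3 p] rel assms deg3 by (simp add: k_def M_def numeral_eq_Suc)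
  ultimately have phi: "\<phi> 1 - \<phi> 2 = k * (\<phi> 0 - \<phi> 3)" using M by auto
  have k: "k \<noteq> 0"
    using phi G.theta_eq_iff[of 1 2] assms by auto
  have poly_p: "poly p x = coeff p 0 + coeff p 1 * x + coeff p 2 * x\<^sup>2 + k * x ^ 3" for x
  proof -
    have "poly p x = (\<Sum>i\<le>3. coeff p i * x ^ i)"
      unfolding poly_altdef using deg3 by (intro sum.mono_neutral_left) (auto simp: coeff_eq_0)
    then show ?thesis by (simp add: k_def numeral_eq_Suc)
  qed
  \<comment> \<open>Dividing \<open>p(x) - p(y) - x y (x - y)\<close> by \<open>k (x - y)\<close>
    leaves this quadratic: \<open>x y\<close> gets the coefficient \<open>1 - 1/k\<close>, and the
    lower coefficients of \<open>p\<close> supply the other two scalars.\<close>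
  have "(\<theta> (Suc i))\<^sup>2 - (1 / k - 1) * \<theta> (Suc i) * \<theta> i + (\<theta> i)\<^sup>2
      - (- coeff p 2 / k) * (\<theta> (Suc i) + \<theta> i) - (- coeff p 1 / k) = 0" (is "?Q = 0")
    if "Suc i \<le> d" for i
  proof -
    let ?x = "\<theta> (Suc i)" and ?y = "\<theta> i"
    have "(?x - ?y) * (k * ?Q) = poly p ?x - poly p ?y - ?x * ?y * (?x - ?y)"
      unfolding poly_p using k by (simp add: field_simps power2_eq_square power3_eq_cube)
    also have "\<dots> = 0" using p[OF that] by simp
    finally show ?thesis using k F.theta_eq_iff[of "Suc i" i] that by simp
  qed
  with k phi show ?thesis by blast
qed

end

section \<open>Both relations with a common \<open>\<beta>\<close>\<close>

theorem mainTheorem4: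
  fixes s :: "'a::field \<Rightarrow> 'v::ab_group_add \<Rightarrow> 'v"
    and d :: nat
    and A As :: "'v \<Rightarrow> 'v"
    and E Es :: "nat \<Rightarrow> 'v \<Rightarrow> 'v"
  assumes "vector_space s"
    and "vector_space.dim s (UNIV :: 'v set) = d + 1"
    and "d \<ge> 2"
    and "hessenberg_system s d A E As Es"
    and "tridiagonal_hessenberg_system s d A E As Es"
  shows "TD_system s d A E As Es"
proof -
  interpret vector_space s by fact
  note H = assms(4)[unfolded hessenberg_system_def]
  obtain \<theta> v c where F: "eigenbasis s d A \<theta> v c"
    and E: "\<And>i x. i \<le> d \<Longrightarrow> E i x = s (c i x) (v i)"
    using exists_eigenbasis[OF assms(1), of A d E] H by metis
  obtain \<phi> w e where G: "eigenbasis s d As \<phi> w e"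
    and Es: "\<And>i x. i \<le> d \<Longrightarrow> Es i x = s (e i x) (w i)"
    using exists_eigenbasis[OF assms(1), of As d Es] H by metis
  interpret F: eigenbasis s d A \<theta> v c by fact
  interpret G: eigenbasis s d As \<phi> w e by fact
  have v: "v i \<noteq> 0" and w: "w i \<noteq> 0" if "i \<le> d" for i
    using F.c_v[OF that that] G.c_v[OF that that] lin_zero[OF F.c_lin[OF that]]
      lin_zero[OF G.c_lin[OF that]] by auto
  \<comment> \<open>The product has rank at most one, with image in the line of \<open>v i\<close>;
    its value at \<open>v j\<close> decides whether it vanishes.\<close>
  have E_iff: "E i \<circ> As \<circ> E j = (\<lambda>_. 0) \<longleftrightarrow> c i (As (v j)) = 0" if "i \<le> d" "j \<le> d" for i j
  proof -
    have "(E i \<circ> As \<circ> E j) x = s (c j x * c i (As (v j))) (v i)" for x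
      using that by (simp add: E lin_scale[OF G.lin] F.c_simps)
    then show ?thesis using F.c_v[OF that(2,2)] v[OF that(1)]
      by (auto simp: fun_eq_iff dest: spec[of _ "v j"])
  qed
  have Es_iff: "Es i \<circ> A \<circ> Es j = (\<lambda>_. 0) \<longleftrightarrow> e i (A (w j)) = 0" if "i \<le> d" "j \<le> d" for i j
  proof -
    have "(Es i \<circ> A \<circ> Es j) x = s (e j x * e i (A (w j))) (w i)" for x
      using that by (simp add: Es lin_scale[OF F.lin] G.c_simps)
    then show ?thesis using G.c_v[OF that(2,2)] w[OF that(1)]
      by (auto simp: fun_eq_iff dest: spec[of _ "w j"])
  qed
  have tri: "c i (As (v j)) = 0" "e i (A (w j)) = 0" if "i \<le> d" "j \<le> d" "i > j + 1 \<or> j > i + 1" for i j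
    using that H assms(5) E_iff[of i j] Es_iff[of i j]
    unfolding tridiagonal_hessenberg_system_def by auto
  have sub: "c (Suc j) (As (v j)) \<noteq> 0" "e (Suc j) (A (w j)) \<noteq> 0" if "Suc j \<le> d" for j
    using that H E_iff[of "Suc j" j] Es_iff[of "Suc j" j] by auto
  interpret P: half_tridiagonal_pair s d A \<theta> v c As \<phi> w e
    by unfold_locales (use tri sub in auto)
  interpret Q: half_tridiagonal_pair s d As \<phi> w e A \<theta> v c
    by unfold_locales (use tri sub in auto)
  define quad where "quad \<beta> \<gamma> \<rho> x y \<longleftrightarrow> x\<^sup>2 - \<beta> * x * y + y\<^sup>2 - \<gamma> * (x + y) - \<rho> = 0"
    for \<beta> \<gamma> \<rho> x y :: 'a
  have "\<exists>\<beta> \<gamma> \<gamma>s \<rho> \<rho>s. (\<forall>i. Suc i \<le> d \<longrightarrow> quad \<beta> \<gamma> \<rho> (\<theta> (Suc i)) (\<theta> i))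
      \<and> (\<forall>i. Suc i \<le> d \<longrightarrow> quad \<beta> \<gamma>s \<rho>s (\<phi> (Suc i)) (\<phi> i))"
  proof (cases "d = 2")
    case True
    \<comment> \<open>For \<open>\<beta> = 0\<close> the two equations differ by
      \<open>(h 2 - h 0) * (h 2 + h 0 - \<gamma>)\<close>, which suggests \<open>\<gamma>\<close>;
      then \<open>\<rho>\<close> solves the equation for \<open>i = 0\<close>.\<close>
    have "\<forall>i. Suc i \<le> d \<longrightarrow> quad 0 (h 2 + h 0) ((h 0)\<^sup>2 + (h 1)\<^sup>2 - (h 2 + h 0) * (h 0 + h 1)) (h (Suc i)) (h i)"
      for h :: "nat \<Rightarrow> 'a"
    proof (intro allI impI)
      fix i assume "Suc i \<le> d"
      then have "i = 0 \<or> i = 1" using True by auto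
      then show "quad 0 (h 2 + h 0) ((h 0)\<^sup>2 + (h 1)\<^sup>2 - (h 2 + h 0) * (h 0 + h 1)) (h (Suc i)) (h i)"
        by (auto simp: quad_def numeral_eq_Suc algebra_simps)
    qed
    then show ?thesis by blast
  next
    case False
    then have d: "d \<ge> 3" using assms(3) by simp
    obtain k \<gamma> \<rho> where k: "k \<noteq> 0"
      "\<And>i. Suc i \<le> d \<Longrightarrow> quad (1 / k - 1) \<gamma> \<rho> (\<theta> (Suc i)) (\<theta> i)"
      using P.recurrence[OF d] unfolding quad_def by blast
    \<comment> \<open>With the operators exchanged, the extra relation concerns
      \<open>\<theta>\<close>, the sequence that the quadratics for \<open>k\<close> also
      constrain.\<close>
    obtain ks \<gamma>s \<rho>s where ks: "ks \<noteq> 0"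
      "\<And>i. Suc i \<le> d \<Longrightarrow> quad (1 / ks - 1) \<gamma>s \<rho>s (\<phi> (Suc i)) (\<phi> i)"
      "\<theta> 1 - \<theta> 2 = ks * (\<theta> 0 - \<theta> 3)"
      using Q.recurrence[OF d] unfolding quad_def by blast
    define \<beta> where "\<beta> = 1 / k - 1"
    \<comment> \<open>Subtracting consecutive quadratics and cancelling \<open>z - x\<close> gives a
      linear three-term recurrence with constant right-hand side \<open>\<gamma>\<close>.\<close>
    have quad_diff: "(z - x) * (z - \<beta> * y + x - \<gamma>) =
        (z\<^sup>2 - \<beta> * z * y + y\<^sup>2 - \<gamma> * (z + y) - \<rho>) - (y\<^sup>2 - \<beta> * y * x + x\<^sup>2 - \<gamma> * (y + x) - \<rho>)"
      for x y z
      by (simp add: algebra_simps power2_eq_square)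
    have step: "\<theta> (Suc (Suc i)) - \<beta> * \<theta> (Suc i) + \<theta> i = \<gamma>" if "Suc (Suc i) \<le> d" for i
    proof -
      have "(\<theta> (Suc (Suc i)) - \<theta> i) * (\<theta> (Suc (Suc i)) - \<beta> * \<theta> (Suc i) + \<theta> i - \<gamma>) = 0"
        using k(2)[of i] k(2)[of "Suc i"] that unfolding quad_def \<beta>_def[symmetric]
        by (simp add: quad_diff)
      then show ?thesis using F.theta_eq_iff[of "Suc (Suc i)" i] that by simp
    qed
    have "\<theta> 2 - \<beta> * \<theta> 1 + \<theta> 0 = \<theta> 3 - \<beta> * \<theta> 2 + \<theta> 1"
      using step[of 0] step[of 1] d by (simp add: numeral_eq_Suc)
    moreover have "\<theta> 0 - \<theta> 3 - (\<beta> + 1) * (\<theta> 1 - \<theta> 2) =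
        (\<theta> 2 - \<beta> * \<theta> 1 + \<theta> 0) - (\<theta> 3 - \<beta> * \<theta> 2 + \<theta> 1)"
      by (simp add: algebra_simps)
    ultimately have "\<theta> 0 - \<theta> 3 = (\<beta> + 1) * (\<theta> 1 - \<theta> 2)"
      by (metis right_minus_eq)
    then have "\<theta> 1 - \<theta> 2 = k * (\<theta> 0 - \<theta> 3)" using k(1) by (simp add: \<beta>_def)
    \<comment> \<open>Both are the quotient of \<open>\<theta> 1 - \<theta> 2\<close> by
      \<open>\<theta> 0 - \<theta> 3\<close>, which is nonzero; so one \<open>\<beta>\<close> serves
      both relations.\<close>
    then have "k = ks" using ks(3) F.theta_eq_iff[of 0 3] d by auto
    with k ks show ?thesis by blast
  qed
  then obtain \<beta> \<gamma> \<gamma>s \<rho> \<rho>s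
    where "\<And>i. Suc i \<le> d \<Longrightarrow> quad \<beta> \<gamma> \<rho> (\<theta> (Suc i)) (\<theta> i)"
      and "\<And>i. Suc i \<le> d \<Longrightarrow> quad \<beta> \<gamma>s \<rho>s (\<phi> (Suc i)) (\<phi> i)"
    by blast
  note quads = this[unfolded quad_def]
  have "commutator A (td_expr s \<beta> \<gamma> \<rho> A As) = (\<lambda>_. 0)"
    by (rule P.td_relation) (rule quads(1))
  moreover have "commutator As (td_expr s \<beta> \<gamma>s \<rho>s As A) = (\<lambda>_. 0)"
    by (rule Q.td_relation) (rule quads(2))
  ultimately show ?thesis using assms(4) unfolding TD_system_def by blast
qed

end
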